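(* Let $r$ be a square root on an EMV-algebra $M$ and let $x\in M$ be arbitrary. Take any idempotent $a\in\mathcal I(M)$ such that $r(r(0))\le a$ and $x\le a$, and define $w_a=\lambda_a(r(0))\odot\lambda_a(r(0))$. Then $$r(x)=(x\wedge w_a)\vee\Bigl(\bigl((x\wedge\lambda_a(w_a))+\lambda_a(w_a)\bigr)/2\Bigr),$$ where $+$ and division by $2$ are taken in the Abelian unital $\ell$-group $(G_a,a)$ with $([0,a];\oplus,\lambda_a,0,a)=\Gamma(G_a,a)$ (the displayed half existing in $[0,a]$).
   Context: An EMV-algebra is an algebra $(M;\vee,\wedge,\oplus,0)$ of type $(2,2,2,0)$ such that: (E1) $(M;\vee,\wedge,0)$ is a distributive lattice with least element $0$; (E2) $(M;\oplus,0)$ is a commutative ordered monoid with neutral element $0$; (E3) writing $\mathcal I(M)=\{x\in M\mid x\oplus x=x\}$ (the idempotents), for each $a\in\mathcal I(M)$ and each $x\in[0,a]$ the element $\lambda_a(x)=\min\{z\in[0,a]\mid x\oplus z=a\}$ exists, and $([0,a];\oplus,\lambda_a,0,a)$ is an MV-algebra; (E4) for each $x\in M$ there is $a\in\mathcal I(M)$ with $x\le a$. A top element is not assumed. For $x,y\in M$, $x\odot y:=\lambda_a(\lambda_a(x)\oplus\lambda_a(y))$ for any $a\in\mathcal I(M)$ with $x,y\le a$ (this does not depend on $a$). A square root on $M$ is a map $s:M\to M$ such that (Sq1) $s(x)\odot s(x)=x$ for all $x\in M$; (Sq2) for all $x,y\in M$, $y\odot y\le x$ implies $y\le s(x)$.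 For an Abelian unital $\ell$-group $(G,u)$ ($u$ a strong unit), $\Gamma(G,u)$ is the MV-algebra on $[0,u]$ with $x\oplus y=(x+y)\wedge u$ and $x'=u-x$; every MV-algebra is of this form up to isomorphism. $g/2$ denotes the unique $h\in G$ with $h+h=g$, if it exists. *)

theory Defs
  imports "HOL-Library.Lattice_Algebras"
begin

record 'a mv =
  mv_carrier :: "'a set"
  mv_plus :: "'a \<Rightarrow> 'a \<Rightarrow> 'a"
  mv_neg :: "'a \<Rightarrow> 'a"
  mv_zero :: 'a
  mv_one :: 'a

locale mv_algebra =
  fixes A :: "'a mv"
  assumes plus_closed: "x \<in> mv_carrier A \<Longrightarrow> y \<in> mv_carrier A \<Longrightarrow> mv_plus A x y \<in> mv_carrier A"
    and neg_closed: "x \<in> mv_carrier A \<Longrightarrow> mv_neg A x \<in> mv_carrier A"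
    and zero_closed: "mv_zero A \<in> mv_carrier A"
    and one_closed: "mv_one A \<in> mv_carrier A"
    and plus_assoc: "x \<in> mv_carrier A \<Longrightarrow> y \<in> mv_carrier A \<Longrightarrow> z \<in> mv_carrier A \<Longrightarrow>
      mv_plus A (mv_plus A x y) z = mv_plus A x (mv_plus A y z)"
    and plus_commute: "x \<in> mv_carrier A \<Longrightarrow> y \<in> mv_carrier A \<Longrightarrow> mv_plus A x y = mv_plus A y x"
    and plus_zero: "x \<in> mv_carrier A \<Longrightarrow> mv_plus A x (mv_zero A) = x"
    and neg_neg: "x \<in> mv_carrier A \<Longrightarrow> mv_neg A (mv_neg A x) = x"
    and neg_zero: "mv_neg A (mv_zero A) = mv_one A"
    and plus_one: "x \<in> mv_carrier A \<Longrightarrow> mv_plus A x (mv_one A) = mv_one A"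
    and luk: "x \<in> mv_carrier A \<Longrightarrow> y \<in> mv_carrier A \<Longrightarrow>
      mv_plus A x (mv_neg A (mv_plus A x (mv_neg A y))) =
      mv_plus A y (mv_neg A (mv_plus A y (mv_neg A x)))"

definition mv_iso :: "('a \<Rightarrow> 'b) \<Rightarrow> 'a mv \<Rightarrow> 'b mv \<Rightarrow> bool" where
  "mv_iso \<phi> A B \<longleftrightarrow>
    bij_betw \<phi> (mv_carrier A) (mv_carrier B) \<and>
    (\<forall>x\<in>mv_carrier A. \<forall>y\<in>mv_carrier A. \<phi> (mv_plus A x y) = mv_plus B (\<phi> x) (\<phi> y)) \<and>
    (\<forall>x\<in>mv_carrier A. \<phi> (mv_neg A x) = mv_neg B (\<phi> x)) \<and>
    \<phi> (mv_zero A) = mv_zero B \<and>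
    \<phi> (mv_one A) = mv_one B"

text \<open>The operation \<open>+\<close> of the classes below is the truncated sum \<open>\<oplus>\<close> of an EMV-algebra,
  not a group operation. The class \<open>emv_base\<close> collects axioms (E1) and (E2), which suffice to
  define the idempotents and \<open>\<lambda>\<^sub>a\<close>; \<open>emv_algebra\<close> adds (E3) and (E4).\<close>

class emv_base = distrib_lattice + ordered_comm_monoid_add +
  assumes zero_least: "0 \<le> x"
begin

definition idems :: "'a set" where
  "idems = {x. x + x = x}"

definition lam :: "'a \<Rightarrow> 'a \<Rightarrow> 'a" where
  "lam a x = (LEAST z. z \<in> {0..a} \<and> x + z = a)"

definition interval_mv :: "'a \<Rightarrow> 'a mv" where
  "interval_mv a =
    \<lparr>mv_carrier = {0..a}, mv_plus = (+), mv_neg = lam a, mv_zero = 0, mv_one = a\<rparr>"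

end

class emv_algebra = emv_base +
  assumes lam_exists: "a \<in> idems \<Longrightarrow> x \<in> {0..a} \<Longrightarrow>
      \<exists>z. z \<in> {0..a} \<and> x + z = a \<and> (\<forall>z'. z' \<in> {0..a} \<and> x + z' = a \<longrightarrow> z \<le> z')"
    and interval_mv_algebra: "a \<in> idems \<Longrightarrow> mv_algebra (interval_mv a)"
    and idem_above: "\<exists>a\<in>idems. x \<le> a"
begin

text \<open>The value does not depend on the chosen idempotent upper bound of \<open>x\<close> and \<open>y\<close>; one exists
  because the join of two idempotents above \<open>x\<close> and \<open>y\<close> lies below some idempotent.\<close>

definition odot :: "'a \<Rightarrow> 'a \<Rightarrow> 'a" (infixl "\<odot>" 70) where
  "x \<odot> y = (let a = (SOME a. a \<in> idems \<and> x \<le> a \<and> y \<le> a) in lam a (lam a x + lam a y))"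

definition square_root :: "('a \<Rightarrow> 'a) \<Rightarrow> bool" where
  "square_root r \<longleftrightarrow> (\<forall>x. r x \<odot> r x = x) \<and> (\<forall>x y. y \<odot> y \<le> x \<longrightarrow> y \<le> r x)"

end

text \<open>The sum over \<open>i < n\<close> is the \<open>n\<close>-fold multiple of \<open>u\<close>.\<close>

definition strong_unit :: "'g::lattice_ab_group_add \<Rightarrow> bool" where
  "strong_unit u \<longleftrightarrow> 0 \<le> u \<and> (\<forall>g. \<exists>n::nat. g \<le> (\<Sum>i<n. u))"

definition Gamma_mv :: "'g::lattice_ab_group_add \<Rightarrow> 'g mv" where
  "Gamma_mv u =
    \<lparr>mv_carrier = {0..u}, mv_plus = (\<lambda>x y. inf (x + y) u), mv_neg = (\<lambda>x. u - x),
     mv_zero = 0, mv_one = u\<rparr>"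

text \<open>Meaningful only if \<open>g\<close> has a half; halves are unique because lattice-ordered groups are
  torsion-free.\<close>

definition half :: "'g::lattice_ab_group_add \<Rightarrow> 'g" where
  "half g = (THE h. h + h = g)"

lemma half_eqI:
  fixes h :: "'g::lattice_ab_group_add"
  assumes "h + h = g"
  shows "half g = h"
  unfolding half_def
proof (rule the_equality)
  fix k assume "k + k = g"
  then have "(k - h) + (k - h) = 0" using assms by (simp add: algebra_simps)
  then show "k = h" by simp
qed (fact assms)

end

theory Submission
  imports Defs
begin

text \<open>Complements in two intervals \<open>[0,a] \<subseteq> [0,b]\<close> are compared by residuation, which makes
  \<open>\<odot>\<close> independent of the interval and, since \<open>r 0 \<le> a\<close>, forces \<open>r\<close> to preserve \<open>[0,a]\<close>.
  So \<open>r\<close> becomes a square root \<open>s\<close> on \<open>[0,u]\<close>. There \<open>t = s 0\<close> is the largest element with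
  \<open>2t \<le> u\<close>, hence \<open>e = u - 2t\<close> dominates no \<open>2c\<close> with \<open>c > 0\<close>. This splits \<open>[0,u]\<close> into
  \<open>[0,e]\<close>, which is Boolean and on which \<open>s\<close> is the identity, and \<open>[0,2t]\<close>, where every
  element has a half and \<open>s z = (z + 2t) / 2\<close>.\<close>

section \<open>Complements in the intervals of an EMV-algebra\<close>

context emv_algebra
begin

context
  fixes b :: 'a
  assumes b: "b \<in> idems"
begin

section \<open>MV-algebra laws of the intervals \<open>[0,b]\<close>\<close>

lemma plus_le_idem: "x \<le> b \<Longrightarrow> y \<le> b \<Longrightarrow> x + y \<le> b"
  using mv_algebra.plus_closed[OF interval_mv_algebra[OF b], of x y]
  by (simp add: interval_mv_def zero_least)

lemma lam_le: "x \<le> b \<Longrightarrow> lam b x \<le> b"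
  using mv_algebra.neg_closed[OF interval_mv_algebra[OF b], of x]
  by (simp add: interval_mv_def zero_least)

lemma lam_lam: "x \<le> b \<Longrightarrow> lam b (lam b x) = x"
  using mv_algebra.neg_neg[OF interval_mv_algebra[OF b], of x]
  by (simp add: interval_mv_def zero_least)

lemma lam_zero: "lam b 0 = b"
  using mv_algebra.neg_zero[OF interval_mv_algebra[OF b]]
  by (simp add: interval_mv_def)

lemma lam_top: "lam b b = 0"
  using lam_lam[of 0] by (simp add: lam_zero zero_least)

lemma lam_luk: "x \<le> b \<Longrightarrow> y \<le> b \<Longrightarrow> x + lam b (x + lam b y) = y + lam b (y + lam b x)"
  using mv_algebra.luk[OF interval_mv_algebra[OF b], of x y]
  by (simp add: interval_mv_def zero_least)

lemma plus_lam:
  assumes "x \<le> b"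
  shows "x + lam b x = b"
proof -
  have "b + lam b (b + lam b x) = b"
    using mv_algebra.plus_one[OF interval_mv_algebra[OF b], of "lam b (b + lam b x)"]
      mv_algebra.plus_one[OF interval_mv_algebra[OF b], of "lam b x"] assms
    by (simp add: interval_mv_def zero_least lam_top lam_le add.commute)
  then show ?thesis using lam_luk[of x b] assms by (simp add: lam_top)
qed

lemma lam_least:
  assumes "x \<le> b" "z \<le> b" "x + z = b"
  shows "lam b x \<le> z"
proof -
  obtain m where m: "m \<in> {0..b} \<and> x + m = b"
      "\<forall>z'. z' \<in> {0..b} \<and> x + z' = b \<longrightarrow> m \<le> z'"
    using lam_exists[OF b, of x] assms zero_least by auto
  have "lam b x = m"
    unfolding lam_def using m by (intro Least_equality) auto
  then show ?thesis using m assms zero_least by auto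
qed

text \<open>By involution, \<open>x\<close> is the least element of \<open>[0,b]\<close> whose sum
  with \<open>lam b x\<close> is \<open>b\<close>; monotonicity of the sum gives the
  converse.\<close>

lemma le_iff_lam_plus:
  assumes "x \<le> b" "y \<le> b"
  shows "x \<le> y \<longleftrightarrow> lam b x + y = b"
proof
  assume "x \<le> y"
  then have "lam b x + x \<le> lam b x + y" by (rule add_left_mono)
  then show "lam b x + y = b"
    using plus_lam[OF assms(1)] plus_le_idem[OF lam_le[OF assms(1)] assms(2)]
    by (simp add: add.commute order.antisym)
next
  assume "lam b x + y = b"
  then show "x \<le> y"
    using lam_least[of "lam b x" y] assms by (simp add: lam_le lam_lam)
qed

lemma lam_antimono:
  assumes "x \<le> y" "y \<le> b"
  shows "lam b y \<le> lam b x"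
proof -
  have "x \<le> b" using assms by (rule order.trans)
  then show ?thesis
    using assms le_iff_lam_plus[of x y] lam_least[of y "lam b x"]
    by (simp add: lam_le add.commute)
qed

text \<open>The term \<open>lam b (x + lam b y)\<close> is the truncated difference of
  \<open>y\<close> and \<open>x\<close>. Since \<open>y + lam b x = b\<close>, the other side of the
  Lukasiewicz identity collapses to \<open>y\<close>.\<close>

lemma le_divisible:
  assumes "x \<le> y" "y \<le> b"
  shows "x + lam b (x + lam b y) = y"
proof -
  have x: "x \<le> b" using assms by (rule order.trans)
  have "y + lam b x = b" using assms x le_iff_lam_plus[of x y] by (simp add: add.commute)
  then show ?thesis using lam_luk[of x y] x assms by (simp add: lam_top)
qed

text \<open>Residuation for the product computed in \<open>[0,b]\<close>: by
  \<open>le_iff_lam_plus\<close> both inequalities mean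
  \<open>lam b x + lam b y + z = b\<close>.\<close>

lemma otimes_le_iff:
  assumes "x \<le> b" "y \<le> b" "z \<le> b"
  shows "lam b (lam b x + lam b y) \<le> z \<longleftrightarrow> x \<le> lam b y + z"
  using assms le_iff_lam_plus[of "lam b (lam b x + lam b y)" z] le_iff_lam_plus[of x "lam b y + z"]
  by (simp add: lam_le lam_lam plus_le_idem add.assoc)

lemma otimes_le:
  assumes "x \<le> b" "y \<le> b"
  shows "lam b (lam b x + lam b y) \<le> x"
  using assms by (simp add: otimes_le_iff add_increasing zero_least)

lemma otimes_mono:
  assumes "x \<le> x'" "y \<le> y'" "x' \<le> b" "y' \<le> b"
  shows "lam b (lam b x + lam b y) \<le> lam b (lam b x' + lam b y')"
proof -
  have "x \<le> b" "y \<le> b" using assms order.trans by blast+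
  then show ?thesis
    using assms by (intro lam_antimono add_mono plus_le_idem lam_le)
qed

section \<open>Idempotents below \<open>b\<close>\<close>

lemma lam_idem:
  assumes "a \<le> b" "a \<in> idems"
  shows "lam b a + lam b a = lam b a"
proof -
  have "a + a = a" using assms(2) by (simp add: idems_def)
  then have "lam b a + lam b (lam b a + lam b a) = b"
    using lam_luk[of a "lam b a"] assms by (simp add: lam_le lam_lam plus_lam)
  \<comment> \<open>By minimality \<open>a\<close> lies below its own square in
    \<open>[0,b]\<close>; taking complements bounds \<open>lam b a + lam b a\<close> by
    \<open>lam b a\<close>.\<close>
  then have "a \<le> lam b (lam b a + lam b a)"
    using lam_least[of "lam b a" "lam b (lam b a + lam b a)"] assms
    by (simp add: lam_le lam_lam plus_le_idem)
  then have "lam b a + lam b a \<le> lam b a"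
    using lam_antimono[of a "lam b (lam b a + lam b a)"] assms
    by (simp add: lam_le lam_lam plus_le_idem)
  moreover have "lam b a \<le> lam b a + lam b a"
    by (simp add: add_increasing zero_least)
  ultimately show ?thesis by (rule order.antisym)
qed

text \<open>The element \<open>lam b x\<close> lies above the idempotent \<open>lam b a\<close>, so
  it has the form \<open>lam b a + d\<close> and absorbs a further summand
  \<open>lam b a\<close>.\<close>

lemma otimes_idem:
  assumes "a \<le> b" "a \<in> idems" "x \<le> a"
  shows "lam b (lam b x + lam b a) = x"
proof -
  have x: "x \<le> b" using assms by (blast intro: order.trans)
  obtain d where d: "lam b a + d = lam b x"
    using le_divisible[of "lam b a" "lam b x"] lam_antimono[of x a] assms x lam_le by blast
  have "lam b x + lam b a = (lam b a + lam b a) + d"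
    by (simp add: d[symmetric] ac_simps)
  also have "\<dots> = lam b x" using d lam_idem[OF assms(1,2)] by simp
  finally show ?thesis using x by (simp add: lam_lam)
qed

text \<open>Multiplication by \<open>a\<close> fixes \<open>x\<close> but annihilates its upper
  bound \<open>lam b a\<close>.\<close>

lemma disjoint_lam_idem:
  assumes "a \<le> b" "a \<in> idems" "x \<le> a" "x \<le> lam b a"
  shows "x = 0"
proof -
  have "x \<le> lam b (lam b (lam b a) + lam b a)"
    using otimes_mono[of x "lam b a" a a] otimes_idem[of a x] assms by (simp add: lam_le)
  then have "x \<le> 0" using assms by (simp add: lam_lam plus_lam lam_top)
  then show ?thesis using zero_least by (simp add: order.antisym)
qed

end

text \<open>Both products lie in \<open>[0,a]\<close>, and by residuation they have the same upper
  bounds there: the two complements of \<open>y\<close> differ by at most \<open>lam b a\<close>,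
  which does not affect upper bounds of \<open>x \<le> a\<close>.\<close>

lemma otimes_eq:
  assumes a: "a \<in> idems" and b: "b \<in> idems" and "a \<le> b" and x: "x \<le> a" and y: "y \<le> a"
  shows "lam a (lam a x + lam a y) = lam b (lam b x + lam b y)"
proof -
  have xb: "x \<le> b" and yb: "y \<le> b" using assms order.trans by blast+
  \<comment> \<open>The difference of \<open>a\<close> and \<open>y\<close> taken in
    \<open>[0,b]\<close> competes in the minimality of \<open>lam a y\<close>.\<close>
  have "y + lam b (y + lam b a) = a"
    using le_divisible[OF b y \<open>a \<le> b\<close>] .
  moreover have "lam b (y + lam b a) \<le> a"
    using otimes_le_iff[OF b, of "lam b y" a a] lam_le[OF b yb] lam_lam[OF b yb]
      lam_le[OF b \<open>a \<le> b\<close>] plus_lam[OF b \<open>a \<le> b\<close>] \<open>a \<le> b\<close>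
    by (simp add: add.commute)
  moreover have "lam b (y + lam b a) \<le> lam b y"
    by (intro lam_antimono[OF b] plus_le_idem[OF b] lam_le[OF b] yb \<open>a \<le> b\<close>)
      (simp add: add_increasing2 zero_least)
  ultimately have 1: "lam a y \<le> lam b y"
    using lam_least[OF a y] by (blast intro: order.trans)
  have ay: "lam a y \<le> b" using lam_le[OF a y] \<open>a \<le> b\<close> by (rule order.trans)
  have "y + (lam a y + lam b a) = b"
    using plus_lam[OF a y] plus_lam[OF b \<open>a \<le> b\<close>] by (simp add: add.assoc[symmetric])
  then have 2: "lam b y \<le> lam a y + lam b a"
    by (intro lam_least[OF b] plus_le_idem[OF b] lam_le[OF b] ay yb \<open>a \<le> b\<close>)
  have key: "x \<le> lam a y + z \<longleftrightarrow> x \<le> lam b y + z" if "z \<le> a" for z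
  proof
    assume "x \<le> lam a y + z"
    also have "\<dots> \<le> lam b y + z" using 1 by (rule add_right_mono)
    finally show "x \<le> lam b y + z" .
  next
    assume "x \<le> lam b y + z"
    also have "\<dots> \<le> (lam a y + lam b a) + z" using 2 by (rule add_right_mono)
    finally have "x \<le> lam b a + (lam a y + z)" by (simp add: ac_simps)
    moreover have "lam a y + z \<le> b"
      using ay that \<open>a \<le> b\<close> order.trans plus_le_idem[OF b] by blast
    \<comment> \<open>Residuation trades the summand \<open>lam b a\<close> for multiplication by
      \<open>a\<close>, which fixes \<open>x\<close>.\<close>
    ultimately have "lam b (lam b x + lam b a) \<le> lam a y + z"
      using otimes_le_iff[OF b xb \<open>a \<le> b\<close>] by blast
    then show "x \<le> lam a y + z"
      using otimes_idem[OF b \<open>a \<le> b\<close> a x] by simp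
  qed
  let ?p = "lam a (lam a x + lam a y)" and ?q = "lam b (lam b x + lam b y)"
  have pq: "?p \<le> a" "?q \<le> a"
    using otimes_le[OF a x y] otimes_le[OF b xb yb] x order.trans by blast+
  have iff: "?p \<le> z \<longleftrightarrow> ?q \<le> z" if "z \<le> a" for z
    using otimes_le_iff[OF a x y that] otimes_le_iff[OF b xb yb, of z] key[OF that]
      order.trans[OF that \<open>a \<le> b\<close>] by blast
  show ?thesis
    using iff[OF pq(1)] iff[OF pq(2)] by (intro order.antisym) auto
qed

text \<open>The idempotent picked by \<open>SOME\<close> need not be comparable with
  \<open>a\<close>, so both are compared with an idempotent \<open>d\<close> above them.\<close>

lemma odot_eq:
  assumes a: "a \<in> idems" and x: "x \<le> a" and y: "y \<le> a"
  shows "x \<odot> y = lam a (lam a x + lam a y)"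
proof -
  define c where "c = (SOME c. c \<in> idems \<and> x \<le> c \<and> y \<le> c)"
  have c: "c \<in> idems \<and> x \<le> c \<and> y \<le> c"
    unfolding c_def by (rule someI[of _ a]) (use assms in blast)
  obtain d where d: "d \<in> idems" "sup a c \<le> d" using idem_above by blast
  then have "a \<le> d" "c \<le> d" by auto
  have "x \<odot> y = lam c (lam c x + lam c y)" by (simp add: odot_def Let_def c_def)
  also have "\<dots> = lam d (lam d x + lam d y)" using c d \<open>c \<le> d\<close> by (intro otimes_eq) auto
  also have "\<dots> = lam a (lam a x + lam a y)"
    using otimes_eq[OF a d(1) \<open>a \<le> d\<close> x y] by simp
  finally show ?thesis .
qed

section \<open>Square roots and the interval \<open>[0,a]\<close>\<close>

lemma square_root_mono:
  assumes "square_root r" "x \<le> y"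
  shows "r x \<le> r y"
  using assms by (simp add: square_root_def)

text \<open>Let \<open>q\<close> be the product of \<open>r x\<close> and \<open>lam b a\<close>,
  the part of \<open>r x\<close> outside \<open>a\<close>. Its square lies below both
  \<open>a\<close> and \<open>lam b a\<close>, so it is \<open>0\<close>. Hence
  \<open>q \<le> r 0 \<le> a\<close>, while also \<open>q \<le> lam b a\<close>, so
  \<open>q = 0\<close>, and residuation gives the bound.\<close>

lemma square_root_le_idem:
  assumes r: "square_root r" and a: "a \<in> idems" and "r 0 \<le> a" and "x \<le> a"
  shows "r x \<le> a"
proof -
  obtain b where b: "b \<in> idems" and "sup a (r x) \<le> b" using idem_above by blast
  then have ab: "a \<le> b" and rb: "r x \<le> b" by auto
  note la = lam_le[OF b ab]
  define q where "q = lam b (lam b (r x) + lam b (lam b a))"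
  have q1: "q \<le> r x" unfolding q_def by (rule otimes_le[OF b rb la])
  have q2: "q \<le> lam b a"
    unfolding q_def using otimes_le[OF b la rb] by (simp add: add.commute)
  have qb: "q \<le> b" using q1 rb by (rule order.trans)
  have "q \<odot> q \<le> r x \<odot> r x"
    using otimes_mono[OF b q1 q1 rb rb] odot_eq[OF b qb qb] odot_eq[OF b rb rb] by simp
  also have "\<dots> \<le> a" using r \<open>x \<le> a\<close> by (simp add: square_root_def)
  finally have "q \<odot> q \<le> a" .
  moreover have "q \<odot> q \<le> lam b a"
    using otimes_le[OF b qb qb] odot_eq[OF b qb qb] q2 by simp
  ultimately have "q \<odot> q = 0" by (rule disjoint_lam_idem[OF b ab a])
  then have "q \<le> r 0" using r by (simp add: square_root_def)
  then have "q \<le> a" using \<open>r 0 \<le> a\<close> by (rule order.trans)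
  then have "q = 0" using q2 by (rule disjoint_lam_idem[OF b ab a])
  then have "r x \<le> lam b (lam b a) + 0"
    using otimes_le_iff[OF b rb la, of 0] by (simp add: q_def zero_least)
  then show ?thesis by (simp add: lam_lam[OF b ab])
qed

end

section \<open>Square roots on an interval of a lattice-ordered group\<close>

context lattice_ab_group_add
begin

section \<open>Doubling and meets in lattice-ordered groups\<close>

lemma double_le_double_iff: "a + a \<le> b + b \<longleftrightarrow> a \<le> b"
proof -
  have "(b + b) - (a + a) = (b - a) + (b - a)" by (simp add: algebra_simps)
  then show ?thesis
    by (metis diff_ge_0_iff_ge zero_le_double_add_iff_zero_le_single_add)
qed

text \<open>The right side expands to the meet of \<open>a + a\<close>, \<open>a + b\<close> and
  \<open>b + b\<close>; the middle term is redundant because its double is the sum of the other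
  two.\<close>

lemma inf_double: "inf (a + a) (b + b) = inf a b + inf a b"
proof (rule order.antisym)
  let ?m = "inf (a + a) (b + b)"
  have "?m + ?m \<le> (a + a) + (b + b)" by (intro add_mono) auto
  then have "?m + ?m \<le> (a + b) + (a + b)" by (simp add: ac_simps)
  then have "?m \<le> a + b" by (simp only: double_le_double_iff)
  then show "?m \<le> inf a b + inf a b"
    by (simp add: add_inf_distrib_left add_inf_distrib_right add.commute)
qed (auto intro: add_mono)

text \<open>Expanding the right side gives the meet of \<open>a + a\<close>, \<open>a + c\<close>,
  \<open>b + a\<close> and \<open>b + c\<close>; the first three lie above \<open>a\<close> by
  positivity.\<close>

lemma inf_add_le:
  assumes "0 \<le> a" "0 \<le> b" "0 \<le> c"
  shows "inf a (b + c) \<le> inf a b + inf a c"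
  using assms
  by (simp add: add_inf_distrib_left add_inf_distrib_right add_increasing add_increasing2
      le_infI1)

lemma sup_minus_zero: "sup (a - b) 0 = a - inf a b"
  by (simp add: diff_inf_eq_sup add_sup_distrib_left sup.commute)

text \<open>The hypotheses are (Sq1) and (Sq2) in group form, with \<open>sup (y + z - u) 0\<close>
  as the product. In the transfer, \<open>u - F\<close> is the image of \<open>w\<close> and
  \<open>F\<close> that of \<open>lam a w\<close>.\<close>

lemma square_root_on_interval:
  assumes s: "\<And>y. y \<in> {0..u} \<Longrightarrow> s y \<in> {0..u}"
    and root: "\<And>y. y \<in> {0..u} \<Longrightarrow> sup (s y + s y - u) 0 = y"
    and max: "\<And>y z. y \<in> {0..u} \<Longrightarrow> z \<in> {0..u} \<Longrightarrow> sup (y + y - u) 0 \<le> z \<Longrightarrow> y \<le> s z"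
    and x: "x \<in> {0..u}"
  defines "F \<equiv> s 0 + s 0"
  shows "F \<le> u \<and> (\<exists>h\<in>{0..u}. h + h = inf x F + F \<and> s x = sup (inf x (u - F)) h)"
proof -
  define t e where "t = s 0" and "e = u - F"
  have u: "0 \<le> u" using x by (auto intro: order.trans)
  have t: "0 \<le> t" using s[of 0] u by (simp add: t_def)
  have F: "F = t + t" by (simp add: F_def t_def)
  have "sup (F - u) 0 = 0" using root[of 0] u by (simp add: F_def)
  then have "F - u \<le> 0" by (metis sup_ge1)
  then have Fu: "F \<le> u" by simp
  have F0: "0 \<le> F" using t by (simp add: F)
  have e0: "0 \<le> e" using Fu by (simp add: e_def)
  have eF: "e + F = u" by (simp add: e_def)
  \<comment> \<open>Otherwise \<open>t + c\<close> would exceed \<open>t\<close> while still having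
    square \<open>0\<close>.\<close>
  have no_halves: "c = 0" if "0 \<le> c" "c + c \<le> e" for c
  proof -
    have "(t + c) + (t + c) = F + (c + c)" by (simp add: F ac_simps)
    also have "\<dots> \<le> F + e" using that by simp
    finally have 1: "(t + c) + (t + c) \<le> u" using eF by (simp add: add.commute)
    have 2: "0 \<le> t + c" using t that by simp
    then have "t + c \<le> (t + c) + (t + c)" by simp
    then have "t + c \<le> u" using 1 by (rule order.trans)
    moreover have "sup ((t + c) + (t + c) - u) 0 \<le> 0" using 1 by simp
    ultimately have "t + c \<le> s 0" using 2 u by (intro max) auto
    then show ?thesis using that by (simp add: t_def)
  qed
  \<comment> \<open>This dualizes \<open>root\<close>: the complement of the root of
    \<open>u - z\<close> doubles to \<open>z\<close> up to truncation at \<open>u\<close>.\<close>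
  have truncated_half: "\<exists>q\<ge>0. inf (q + q) u = z" if "z \<in> {0..u}" for z
  proof -
    let ?v = "s (u - z)"
    have v: "u - z \<in> {0..u}" using that by (simp add: diff_le_eq)
    have "inf ((u - ?v) + (u - ?v)) u = u - sup (?v + ?v - u) 0"
      by (simp add: diff_sup_eq_inf add_inf_distrib_left algebra_simps)
    also have "\<dots> = z" unfolding root[OF v] by (simp add: algebra_simps)
    finally show ?thesis using s[OF v] by (intro exI[of _ "u - ?v"]) simp
  qed
  \<comment> \<open>Truncation at \<open>u\<close> cannot be seen below \<open>F\<close>, so
    truncated halves yield exact halves there.\<close>
  have inf_u: "inf a F = inf (inf a u) F" for a
    using Fu by (simp add: inf.absorb2 inf.assoc)
  have eF0: "inf e F = 0"
  proof -
    obtain q where q: "0 \<le> q" "inf (q + q) u = e"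
      using truncated_half[of e] e0 F0 by (auto simp: e_def diff_le_eq)
    \<comment> \<open>Halving \<open>inf e F\<close> by means of \<open>t\<close> and a truncated
      half of \<open>e\<close> produces an element whose double is below \<open>e\<close>, which
      \<open>no_halves\<close> forces to be \<open>0\<close>.\<close>
    have d: "inf q t + inf q t = inf e F"
      using inf_double[of q t] inf_u[of "q + q"] q by (simp add: F)
    have "inf q t = 0"
      using q t d by (intro no_halves) auto
    then show ?thesis using d by simp
  qed
  have boolean: "inf z (e - z) = 0" if "0 \<le> z" "z \<le> e" for z
  proof (rule no_halves)
    show "0 \<le> inf z (e - z)" using that by simp
    have "inf z (e - z) + inf z (e - z) \<le> z + (e - z)" by (intro add_mono) auto
    also have "\<dots> = e" by (simp add: algebra_simps)
    finally show "inf z (e - z) + inf z (e - z) \<le> e" .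
  qed
  have disj: "inf a b = 0" if "0 \<le> a" "a \<le> e" "0 \<le> b" "b \<le> F" for a b
    using that eF0 inf_mono[of a e b F] by (intro order.antisym) auto
  \<comment> \<open>As \<open>e\<close> and \<open>F\<close> are disjoint with sum \<open>u\<close>,
    every element of \<open>[0,u]\<close> is the sum of its two components.\<close>
  have split: "inf y e + inf y F = y" if "y \<in> {0..u}" for y
  proof (rule order.antisym)
    have y: "0 \<le> y" "y \<le> u" using that by auto
    have "inf (inf y e) (inf y F) = 0"
      by (rule disj) (use y e0 F0 in auto)
    then show "inf y e + inf y F \<le> y"
      using add_eq_inf_sup[of "inf y e" "inf y F"] by simp
    have "y = inf y (e + F)" using y eF by (simp add: inf.absorb1)
    also have "\<dots> \<le> inf y e + inf y F" using y e0 F0 by (intro inf_add_le)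
    finally show "y \<le> inf y e + inf y F" .
  qed
  define z m where "z = inf x e" and "m = inf x F"
  have zm: "z + m = x" using split[OF x] by (simp add: z_def m_def)
  have z: "0 \<le> z" "z \<le> e" using x e0 by (auto simp: z_def)
  have m: "0 \<le> m" "m \<le> F" "m \<le> u" using x F0 by (auto simp: m_def intro: le_infI1)
  obtain q where q: "0 \<le> q" "inf (q + q) u = m"
    using truncated_half[of m] m by auto
  \<comment> \<open>Here \<open>inf q t\<close> is an exact half of \<open>m\<close>, and
    \<open>t\<close> is a half of \<open>F\<close>.\<close>
  define h where "h = inf q t + t"
  have "inf q t + inf q t = m"
    using inf_double[of q t] inf_u[of "q + q"] q m by (simp add: F inf.absorb1)
  then have hh: "h + h = m + F" by (simp add: h_def F ac_simps)
  have h0: "0 \<le> h" using q t by (simp add: h_def)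
  have hF: "h \<le> F" by (simp add: h_def F)
  have hu: "h \<le> u" using hF Fu by (rule order.trans)
  \<comment> \<open>The join of disjoint elements is their sum, so it remains to show
    \<open>s x = z + h\<close>.\<close>
  have sup_zh: "sup z h = z + h"
    using add_eq_inf_sup[of z h] disj[of z h] z h0 hF by simp
  have zh_u: "z + h \<le> u" using add_mono[OF z(2) hF] eF by simp
  \<comment> \<open>Lower bound: the square of \<open>z + h\<close> is \<open>x\<close> itself,
    since \<open>x\<close> is disjoint from \<open>e - z\<close>; then \<open>max\<close>
    applies.\<close>
  have "sup ((z + h) + (z + h) - u) 0 = sup (x - (e - z)) 0"
  proof -
    have "(z + h) + (z + h) = z + z + (h + h)" by (simp add: ac_simps)
    also have "\<dots> = x + (z + F)" by (simp add: hh zm[symmetric] ac_simps)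
    finally show ?thesis by (simp add: eF[symmetric] algebra_simps)
  qed
  also have "\<dots> = x - inf x (e - z)" by (rule sup_minus_zero)
  also have "inf x (e - z) = inf z (e - z)"
  proof -
    have "e - z \<le> e" using z by (simp add: diff_le_eq)
    then show ?thesis by (simp add: z_def inf.assoc inf.absorb2)
  qed
  also have "\<dots> = 0" using z by (rule boolean)
  finally have "z + h \<le> s x"
    using z h0 zh_u x by (intro max) auto
  \<comment> \<open>Upper bound: the components of \<open>s x\<close> below \<open>e\<close> and
    \<open>F\<close> are compared with \<open>z\<close> and \<open>h\<close> separately.\<close>
  moreover have "s x \<le> z + h"
  proof -
    define p where "p = s x"
    have p: "p \<in> {0..u}" "0 \<le> p" "p \<le> u" using s[OF x] by (auto simp: p_def)
    have px: "sup (p + p - u) 0 = x" using root[OF x] by (simp add: p_def)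
    define b n where "b = inf p e" and "n = inf p F"
    have b: "0 \<le> b" "b \<le> e" "b \<le> p" using p e0 by (auto simp: b_def)
    \<comment> \<open>Being disjoint from its complement in \<open>[0,u]\<close>, \<open>b\<close>
      equals its own square, which lies below the square \<open>x\<close> of
      \<open>p\<close>.\<close>
    have "inf b (u - b) = inf b ((e - b) + F)" using eF by (simp add: algebra_simps)
    also have "\<dots> \<le> inf b (e - b) + inf b F" using b F0 by (intro inf_add_le) auto
    also have "\<dots> = 0" using boolean[OF b(1,2)] disj[of b F] b F0 by simp
    finally have "b - 0 \<le> b - inf b (u - b)" by (rule diff_left_mono)
    then have "b \<le> b - inf b (u - b)" by (simp only: diff_0_right)
    also have "\<dots> = sup (b + b - u) 0"
      unfolding sup_minus_zero[symmetric] by (simp add: algebra_simps)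
    also have "\<dots> \<le> sup (p + p - u) 0"
      using b by (intro sup_mono diff_right_mono add_mono) auto
    finally have bz: "b \<le> z" using px b by (simp add: z_def)
    have "p + p - u \<le> x" using px by (metis sup_ge1)
    then have pp: "p + p \<le> x + u" by (simp add: algebra_simps)
    \<comment> \<open>Meeting \<open>p + p \<le> (m + F) + (z + e)\<close> with \<open>F + F\<close>
      removes \<open>z + e\<close>, because \<open>e + e\<close> is disjoint from
      \<open>F + F\<close>.\<close>
    have "n + n = inf (F + F) (p + p)" by (simp add: n_def inf_double inf.commute)
    also have "\<dots> \<le> inf (F + F) (x + u)" using pp by (intro inf_mono) auto
    also have "x + u = (m + F) + (z + e)" by (simp add: zm[symmetric] eF[symmetric] ac_simps)
    also have "inf (F + F) \<dots> \<le> inf (F + F) (m + F) + inf (F + F) (z + e)"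
      using F0 m z e0 by (intro inf_add_le) auto
    also have "\<dots> \<le> (m + F) + inf (F + F) (e + e)"
      using z by (intro add_mono inf_mono) auto
    also have "\<dots> = h + h" using eF0 by (simp add: inf_double inf.commute[of F] hh)
    finally have "n \<le> h" by (simp only: double_le_double_iff)
    with bz have "b + n \<le> z + h" by (rule add_mono)
    then show ?thesis using split[OF p(1)] by (simp add: b_def n_def p_def)
  qed
  ultimately have "s x = sup z h" unfolding sup_zh by (rule order.antisym[rotated])
  then show ?thesis using Fu h0 hu hh by (auto simp: z_def m_def e_def)
qed

end

section \<open>Transfer to the group\<close>

text \<open>On both sides the order is expressed by sum, complement and top, all preserved by
  \<phi>; injectivity reflects the equation.\<close>

lemma mv_iso_le_iff:
  fixes a :: "'a::emv_algebra" and u :: "'g::lattice_ab_group_add"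
  assumes iso: "mv_iso \<phi> (interval_mv a) (Gamma_mv u)"
    and a: "a \<in> idems" and x: "x \<in> {0..a}" and y: "y \<in> {0..a}"
  shows "\<phi> x \<le> \<phi> y \<longleftrightarrow> x \<le> y"
proof -
  have inj: "inj_on \<phi> {0..a}"
    using iso by (simp add: mv_iso_def interval_mv_def bij_betw_def)
  have l: "lam a x \<in> {0..a}" and p: "lam a x + y \<in> {0..a}" and "a \<in> {0..a}"
    using x y lam_le[OF a] plus_le_idem[OF a] by (auto simp: zero_least)
  have "x \<le> y \<longleftrightarrow> lam a x + y = a"
    using le_iff_lam_plus[OF a] x y by simp
  also have "\<dots> \<longleftrightarrow> \<phi> (lam a x + y) = \<phi> a"
    using inj_on_eq_iff[OF inj p \<open>a \<in> {0..a}\<close>] by simp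
  also have "\<dots> \<longleftrightarrow> inf ((u - \<phi> x) + \<phi> y) u = u"
    using iso x y l by (simp add: mv_iso_def interval_mv_def Gamma_mv_def)
  also have "\<dots> \<longleftrightarrow> u \<le> (u - \<phi> x) + \<phi> y"
    by (metis inf.absorb_iff2)
  also have "\<dots> \<longleftrightarrow> \<phi> x \<le> \<phi> y" by (simp add: algebra_simps)
  finally show ?thesis by simp
qed

theorem corollary5p17:
  fixes r :: "'a::emv_algebra \<Rightarrow> 'a"
    and x a w :: 'a
    and u :: "'g::lattice_ab_group_add"
    and \<phi> :: "'a \<Rightarrow> 'g"
  assumes "square_root r"
    and "a \<in> idems" and "r (r 0) \<le> a" and "x \<le> a"
    and "w = lam a (r 0) \<odot> lam a (r 0)"
    and "strong_unit u"
    and "mv_iso \<phi> (interval_mv a) (Gamma_mv u)"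
  defines "g \<equiv> \<phi> (inf x (lam a w)) + \<phi> (lam a w)"
  shows "half g + half g = g \<and> half g \<in> {0..u} \<and>
    r x = sup (inf x w) (inv_into {0..a} \<phi> (half g))"
proof -
  note r = assms(1) and a = assms(2) and iso = assms(7)
  define \<psi> where "\<psi> = inv_into {0..a} \<phi>"
  have bij: "bij_betw \<phi> {0..a} {0..u}"
    and hom_plus: "\<And>y z. y \<in> {0..a} \<Longrightarrow> z \<in> {0..a} \<Longrightarrow> \<phi> (y + z) = inf (\<phi> y + \<phi> z) u"
    and hom_lam: "\<And>y. y \<in> {0..a} \<Longrightarrow> \<phi> (lam a y) = u - \<phi> y"
    and hom_0: "\<phi> 0 = 0"
    using iso by (simp_all add: mv_iso_def interval_mv_def Gamma_mv_def)
  have \<phi>: "\<phi> y \<in> {0..u}" if "y \<in> {0..a}" for y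
    using bij that by (auto simp: bij_betw_def)
  have \<psi>: "\<psi> k \<in> {0..a}" "\<phi> (\<psi> k) = k" if "k \<in> {0..u}" for k
    unfolding \<psi>_def using bij that
    by (simp_all only: bij_betw_def inv_into_into f_inv_into_f)
  have \<psi>\<phi>: "\<psi> (\<phi> y) = y" if "y \<in> {0..a}" for y
    unfolding \<psi>_def using bij that by (auto simp: bij_betw_def)
  have le_iff: "\<phi> y \<le> \<phi> z \<longleftrightarrow> y \<le> z" if "y \<in> {0..a}" "z \<in> {0..a}" for y z
    by (rule mv_iso_le_iff[OF iso a that])
  have lam_in: "lam a y \<in> {0..a}" if "y \<in> {0..a}" for y
    using lam_le[OF a] that by (simp add: zero_least)
  have odot_in: "y \<odot> z \<in> {0..a}" if "y \<in> {0..a}" "z \<in> {0..a}" for y z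
    using that odot_eq[OF a, of y z] order.trans[OF otimes_le[OF a, of y z], of a]
    by (simp add: zero_least)
  have hom_odot: "\<phi> (y \<odot> z) = sup (\<phi> y + \<phi> z - u) 0" if "y \<in> {0..a}" "z \<in> {0..a}" for y z
  proof -
    have "\<phi> (y \<odot> z) = u - inf ((u - \<phi> y) + (u - \<phi> z)) u"
      using that plus_le_idem[OF a] lam_le[OF a]
      by (simp add: odot_eq[OF a] hom_lam hom_plus lam_in zero_least)
    then show ?thesis
      by (simp add: diff_inf_eq_sup add_sup_distrib_left algebra_simps)
  qed
  have inf_in: "inf y z \<in> {0..a}" and sup_in: "sup y z \<in> {0..a}"
    if "y \<in> {0..a}" "z \<in> {0..a}" for y z
    using that by (auto simp: zero_least intro: le_infI1)
  \<comment> \<open>An MV-isomorphism is only required to respect sum, complement and constants.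
    Meets are recovered from the order by pulling the meet in \<open>[0,u]\<close> back along
    \<psi>.\<close>
  have hom_inf: "\<phi> (inf y z) = inf (\<phi> y) (\<phi> z)" if yz: "y \<in> {0..a}" "z \<in> {0..a}" for y z
  proof (rule antisym)
    show "\<phi> (inf y z) \<le> inf (\<phi> y) (\<phi> z)"
      using le_iff[OF inf_in[OF yz] yz(1)] le_iff[OF inf_in[OF yz] yz(2)] by simp
    have k: "inf (\<phi> y) (\<phi> z) \<in> {0..u}"
      using \<phi>[OF yz(1)] \<phi>[OF yz(2)] by (auto intro: le_infI1)
    have "\<psi> (inf (\<phi> y) (\<phi> z)) \<le> y" "\<psi> (inf (\<phi> y) (\<phi> z)) \<le> z"
      using le_iff[OF \<psi>(1)[OF k] yz(1)] le_iff[OF \<psi>(1)[OF k] yz(2)] \<psi>(2)[OF k] by simp_all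
    then show "inf (\<phi> y) (\<phi> z) \<le> \<phi> (inf y z)"
      using le_iff[OF \<psi>(1)[OF k] inf_in[OF yz]] \<psi>(2)[OF k] by simp
  qed
  have hom_sup: "\<phi> (sup y z) = sup (\<phi> y) (\<phi> z)" if yz: "y \<in> {0..a}" "z \<in> {0..a}" for y z
  proof (rule antisym)
    show "sup (\<phi> y) (\<phi> z) \<le> \<phi> (sup y z)"
      using le_iff[OF yz(1) sup_in[OF yz]] le_iff[OF yz(2) sup_in[OF yz]] by simp
    have k: "sup (\<phi> y) (\<phi> z) \<in> {0..u}"
      using \<phi>[OF yz(1)] \<phi>[OF yz(2)] by (auto intro: le_supI1)
    have "y \<le> \<psi> (sup (\<phi> y) (\<phi> z))" "z \<le> \<psi> (sup (\<phi> y) (\<phi> z))"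
      using le_iff[OF yz(1) \<psi>(1)[OF k]] le_iff[OF yz(2) \<psi>(1)[OF k]] \<psi>(2)[OF k] by simp_all
    then show "\<phi> (sup y z) \<le> sup (\<phi> y) (\<phi> z)"
      using le_iff[OF sup_in[OF yz] \<psi>(1)[OF k]] \<psi>(2)[OF k] by simp
  qed
  have "r 0 \<le> r (r 0)" by (rule square_root_mono[OF r zero_least])
  then have r0: "r 0 \<le> a" using assms(3) by (rule order.trans)
  have r_in: "r y \<in> {0..a}" if "y \<in> {0..a}" for y
    using square_root_le_idem[OF r a r0] that by (simp add: zero_least)
  have x: "x \<in> {0..a}" and z: "0 \<in> {0..a}" using assms(4) by (simp_all add: zero_least)
  \<comment> \<open>This is the square root \<open>r\<close>, restricted to \<open>[0,a]\<close> and
    transported to \<open>[0,u]\<close>.\<close>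
  define s where "s k = \<phi> (r (\<psi> k))" for k
  define F where "F = s 0 + s 0"
  have s\<phi>: "s (\<phi> y) = \<phi> (r y)" if "y \<in> {0..a}" for y
    using that by (simp add: s_def \<psi>\<phi>)
  have "F \<le> u \<and> (\<exists>h\<in>{0..u}. h + h = inf (\<phi> x) F + F \<and> s (\<phi> x) = sup (inf (\<phi> x) (u - F)) h)"
    unfolding F_def
  proof (rule square_root_on_interval)
    fix k assume k: "k \<in> {0..u}"
    show "s k \<in> {0..u}" unfolding s_def by (intro \<phi> r_in \<psi> k)
    have "\<phi> (r (\<psi> k) \<odot> r (\<psi> k)) = \<phi> (\<psi> k)"
      using r by (simp add: square_root_def)
    then show "sup (s k + s k - u) 0 = k"
      using hom_odot r_in \<psi>[OF k] by (simp add: s_def)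
  next
    fix k l assume k: "k \<in> {0..u}" and l: "l \<in> {0..u}" and le: "sup (k + k - u) 0 \<le> l"
    note k' = \<psi>[OF k] and l' = \<psi>[OF l]
    have "\<psi> k \<odot> \<psi> k \<le> \<psi> l"
      using odot_in[OF k'(1) k'(1)] le_iff[of "\<psi> k \<odot> \<psi> k" "\<psi> l"] le hom_odot[OF k'(1) k'(1)] k' l' by simp
    then have "\<psi> k \<le> r (\<psi> l)" using r by (simp add: square_root_def)
    then have "\<phi> (\<psi> k) \<le> \<phi> (r (\<psi> l))"
      using le_iff[OF k'(1) r_in[OF l'(1)]] by simp
    then show "k \<le> s l" using k' by (simp add: s_def)
  next
    show "\<phi> x \<in> {0..u}" by (rule \<phi>[OF x])
  qed
  then obtain h where Fu: "F \<le> u" and h: "h \<in> {0..u}" "h + h = inf (\<phi> x) F + F"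
      "\<phi> (r x) = sup (inf (\<phi> x) (u - F)) h"
    using s\<phi>[OF x] by auto
  note lr0 = lam_in[OF r_in[OF z]]
  have s0: "s 0 = \<phi> (r 0)" using s\<phi>[OF z] by (simp add: hom_0)
  have w: "w \<in> {0..a}"
    unfolding assms(5) by (rule odot_in[OF lr0 lr0])
  \<comment> \<open>The square of the complement of \<open>s 0\<close> is
    \<open>(u - s 0) + (u - s 0) - u = u - F\<close>, truncated at \<open>0\<close>.\<close>
  have "\<phi> w = sup (u - F) 0"
    unfolding assms(5) hom_odot[OF lr0 lr0] hom_lam[OF r_in[OF z]] F_def s0
    by (simp add: algebra_simps)
  then have \<phi>w: "\<phi> w = u - F" using Fu by (simp add: sup.absorb1)
  have "\<phi> (lam a w) = F" using hom_lam[OF w] \<phi>w by simp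
  then have "g = h + h"
    unfolding g_def using hom_inf[OF x lam_in[OF w]] h(2) by simp
  then have hg: "half g = h" and gh: "h + h = g" by (auto intro: half_eqI)
  have "\<phi> (sup (inf x w) (\<psi> h)) = \<phi> (r x)"
    using hom_sup[OF inf_in[OF x w] \<psi>(1)[OF h(1)]] hom_inf[OF x w] \<psi>(2)[OF h(1)] \<phi>w h(3)
    by simp
  then have "r x = sup (inf x w) (\<psi> h)"
    by (metis \<psi>\<phi> r_in x sup_in inf_in w \<psi>(1) h(1))
  then show ?thesis using hg gh h(1) by (simp add: \<psi>_def)
qed

end
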